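(* Consider the explicit median bias-corrected estimator applied with focus parameter $\psi = \theta_t$, separately for each $t = 1,\ldots,p$. With $V$, $A$, $C$, $s$, $i$ as defined in the context, the following hold. (1) If the initial estimator is the maximum likelihood estimator $\hat\theta$ (satisfying $s(\hat\theta) = 0_p$), then the vector of median bias-corrected estimators of $\theta_1,\ldots,\theta_p$ is $$\hat\theta + V(\hat\theta) A(\hat\theta) - C(\hat\theta),$$ which is exactly one step, started at $\hat\theta$, of the quasi-Fisher scoring iteration $$\theta := \theta + V(\theta)\{ s(\theta) + A(\theta) - i(\theta) C(\theta)\}$$ for solving the median bias-reducing adjusted score equations $s(\theta) + A(\theta) - i(\theta) C(\theta) = 0_p$. (2) If the initial estimator is the reduced mean-bias estimator $\tilde\theta$, defined as a solution of $s(\theta) + A(\theta) = 0_p$, then the vector of median bias-corrected estimators of $\theta_1,\ldots,\theta_p$ is $$\tilde\theta - C(\tilde\theta),$$ which is exactly one step of the same quasi-Fisher scoring iteration started at $\tilde\theta$.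
   Context: Setting. $\mathcal{M}_\theta$ is a parametric model with parameter $\theta \in \Theta \subset \mathbb{R}^p$ and log-likelihood $l(\theta; Y)$, $Y$ distributed according to $\mathcal{M}_\theta$, satisfying standard regularity conditions for parametric likelihood inference (continuous derivatives and finite expectations of products of log-likelihood derivatives to the required order, invertible expected information). Expectations are under $\mathcal{M}_\theta$. Dependence on $Y$ is suppressed and $0_p$ is the zero $p$-vector. Likelihood quantities. $s = s(\theta) = \nabla l(\theta;Y)$ with elements $s_t$; $j = j(\theta) = -\nabla\nabla^\top l(\theta;Y)$; $i = i(\theta) = \mathrm{E}(j)$; $V = V(\theta) = i^{-1}$ with elements $V_{rs}$; $P_t = P_t(\theta) = \mathrm{E}(s s^\top s_t)$; $Q_t = Q_t(\theta) = -\mathrm{E}(j s_t)$, for $t = 1,\ldots,p$. The $p$-vector $A = A(\theta)$ has elements $A_t = \frac12 \mathrm{trace}\{V(P_t + Q_t)\}$. Writing $v_r$ for the $r$th row of $V$ regarded as a column vector, let $E_r = v_r v_r^\top / V_{rr}$, let $D$ be the $p\times p$ matrix with elements $D_{rs} = \mathrm{trace}\{E_r(P_s/3 + Q_s/2)\}$, and let $C = C(\theta)$ be the $p$-vector with elements $C_r = \sum_{s=1}^p V_{rs} D_{rs}$. Explicit median bias-corrected estimator. For a smooth scalar focus parameter $\psi = h(\theta)$ with gradient $\dot\psi = \nabla h(\theta)$ and Hessian $\ddot\psi = \nabla\nabla^\top h(\theta)$, let $\omega = V\dot\psi$ with elements $\omega_t$, and $$\kappa_2 = \omega^\top\dot\psi,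 \qquad \kappa_3 = -6\sum_{t=1}^p \omega_t\, \omega^\top\left(\tfrac13 P_t + \tfrac12 Q_t\right)\omega + 3\,\omega^\top\ddot\psi\,\omega .$$ Given an initial estimator $\theta^\circ$ of $\theta$, the median bias-corrected estimator of $\psi$ is $$h(\theta^\circ) - b_{(\psi)}(\theta^\circ) + \frac16\,\frac{\kappa_3(\theta^\circ)}{\kappa_2(\theta^\circ)},$$ where $b_{(\psi)}$ is the first-order bias of $h(\theta^\circ)$: $b_{(\psi)} = -(VA)^\top\dot\psi + \frac12\mathrm{trace}(V\ddot\psi)$ when $\theta^\circ$ is the maximum likelihood estimator, and $b_{(\psi)} = \frac12\mathrm{trace}(V\ddot\psi)$ when $\theta^\circ$ is the reduced mean-bias estimator (which has $o(n^{-1})$ mean bias). *)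

theory Defs
  imports "HOL-Probability.Probability"
begin

section \<open>Gradients, Hessians and outer products\<close>

definition grad :: "(real^'p \<Rightarrow> real) \<Rightarrow> real^'p \<Rightarrow> real^'p" where
  "grad h \<theta> = (\<chi> r. frechet_derivative h (at \<theta>) (axis r 1))"

definition hessian :: "(real^'p \<Rightarrow> real) \<Rightarrow> real^'p \<Rightarrow> real^'p^'p" where
  "hessian h \<theta> = (\<chi> r c. grad (\<lambda>\<tau>. grad h \<tau> $ c) \<theta> $ r)"

definition outer :: "real^'p \<Rightarrow> real^'p \<Rightarrow> real^'p^'p" where
  "outer u v = (\<chi> r c. u $ r * v $ c)"

section \<open>Parametric model and likelihood quantities\<close>

text \<open>A model is given by a dominating measure \<open>\<mu>\<close> on the sample space and
  densities \<open>f \<theta>\<close> with respect to it; \<open>\<M>\<^sub>\<theta>\<close> is the measure with density \<open>f \<theta>\<close>.\<close>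

definition model :: "'y measure \<Rightarrow> (real^'p \<Rightarrow> 'y \<Rightarrow> real) \<Rightarrow> real^'p \<Rightarrow> 'y measure" where
  "model \<mu> f \<theta> = density \<mu> (\<lambda>y. ennreal (f \<theta> y))"

definition loglik :: "(real^'p \<Rightarrow> 'y \<Rightarrow> real) \<Rightarrow> 'y \<Rightarrow> real^'p \<Rightarrow> real" where
  "loglik f y \<theta> = ln (f \<theta> y)"

definition score :: "(real^'p \<Rightarrow> 'y \<Rightarrow> real) \<Rightarrow> 'y \<Rightarrow> real^'p \<Rightarrow> real^'p" where
  "score f y \<theta> = grad (loglik f y) \<theta>"

definition obs_info :: "(real^'p \<Rightarrow> 'y \<Rightarrow> real) \<Rightarrow> 'y \<Rightarrow> real^'p \<Rightarrow> real^'p^'p" where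
  "obs_info f y \<theta> = - hessian (loglik f y) \<theta>"

definition exp_info :: "'y measure \<Rightarrow> (real^'p \<Rightarrow> 'y \<Rightarrow> real) \<Rightarrow> real^'p \<Rightarrow> real^'p^'p" where
  "exp_info \<mu> f \<theta> = (\<integral>y. obs_info f y \<theta> \<partial>model \<mu> f \<theta>)"

definition Vmat :: "'y measure \<Rightarrow> (real^'p \<Rightarrow> 'y \<Rightarrow> real) \<Rightarrow> real^'p \<Rightarrow> real^'p^'p" where
  "Vmat \<mu> f \<theta> = matrix_inv (exp_info \<mu> f \<theta>)"

definition Pmat :: "'y measure \<Rightarrow> (real^'p \<Rightarrow> 'y \<Rightarrow> real) \<Rightarrow> 'p \<Rightarrow> real^'p \<Rightarrow> real^'p^'p" where
  "Pmat \<mu> f t \<theta> =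
    (\<integral>y. (score f y \<theta> $ t) *\<^sub>R outer (score f y \<theta>) (score f y \<theta>) \<partial>model \<mu> f \<theta>)"

definition Qmat :: "'y measure \<Rightarrow> (real^'p \<Rightarrow> 'y \<Rightarrow> real) \<Rightarrow> 'p \<Rightarrow> real^'p \<Rightarrow> real^'p^'p" where
  "Qmat \<mu> f t \<theta> =
    - (\<integral>y. (score f y \<theta> $ t) *\<^sub>R obs_info f y \<theta> \<partial>model \<mu> f \<theta>)"

definition Avec :: "'y measure \<Rightarrow> (real^'p \<Rightarrow> 'y \<Rightarrow> real) \<Rightarrow> real^'p \<Rightarrow> real^'p" where
  "Avec \<mu> f \<theta> = (\<chi> t. 1/2 * trace (Vmat \<mu> f \<theta> ** (Pmat \<mu> f t \<theta> + Qmat \<mu> f t \<theta>)))"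

definition Emat :: "'y measure \<Rightarrow> (real^'p \<Rightarrow> 'y \<Rightarrow> real) \<Rightarrow> 'p \<Rightarrow> real^'p \<Rightarrow> real^'p^'p" where
  "Emat \<mu> f r \<theta> =
    (1 / Vmat \<mu> f \<theta> $ r $ r) *\<^sub>R outer (row r (Vmat \<mu> f \<theta>)) (row r (Vmat \<mu> f \<theta>))"

definition PQ :: "'y measure \<Rightarrow> (real^'p \<Rightarrow> 'y \<Rightarrow> real) \<Rightarrow> 'p \<Rightarrow> real^'p \<Rightarrow> real^'p^'p" where
  "PQ \<mu> f t \<theta> = (1/3) *\<^sub>R Pmat \<mu> f t \<theta> + (1/2) *\<^sub>R Qmat \<mu> f t \<theta>"

definition Dmat :: "'y measure \<Rightarrow> (real^'p \<Rightarrow> 'y \<Rightarrow> real) \<Rightarrow> real^'p \<Rightarrow> real^'p^'p" where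
  "Dmat \<mu> f \<theta> = (\<chi> r s. trace (Emat \<mu> f r \<theta> ** PQ \<mu> f s \<theta>))"

definition Cvec :: "'y measure \<Rightarrow> (real^'p \<Rightarrow> 'y \<Rightarrow> real) \<Rightarrow> real^'p \<Rightarrow> real^'p" where
  "Cvec \<mu> f \<theta> = (\<chi> r. \<Sum>s\<in>UNIV. Vmat \<mu> f \<theta> $ r $ s * Dmat \<mu> f \<theta> $ r $ s)"

text \<open>Regularity conditions. Positivity of the densities says that the support does not depend
  on \<open>\<theta>\<close>, with \<open>\<mu>\<close> restricted to the common support. No condition guarantees
  \<open>V\<^sub>r\<^sub>r \<noteq> 0\<close>; that follows from positive definiteness of the information when the second
  Bartlett identity holds, which is not assumed here.\<close>

locale regular_model =
  fixes \<Theta> :: "(real^'p) set"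
    and \<mu> :: "'y measure"
    and f :: "real^'p \<Rightarrow> 'y \<Rightarrow> real"
  assumes open_params: "open \<Theta>"
    and density_measurable: "\<And>\<theta>. \<theta> \<in> \<Theta> \<Longrightarrow> f \<theta> \<in> borel_measurable \<mu>"
    and density_pos: "\<And>\<theta> y. \<theta> \<in> \<Theta> \<Longrightarrow> y \<in> space \<mu> \<Longrightarrow> 0 < f \<theta> y"
    and prob_space_model: "\<And>\<theta>. \<theta> \<in> \<Theta> \<Longrightarrow> prob_space (model \<mu> f \<theta>)"
    and loglik_differentiable:
      "\<And>y. y \<in> space \<mu> \<Longrightarrow> loglik f y differentiable_on \<Theta>"
    and score_differentiable:
      "\<And>y. y \<in> space \<mu> \<Longrightarrow> score f y differentiable_on \<Theta>"
    and obs_info_continuous: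
      "\<And>y. y \<in> space \<mu> \<Longrightarrow> continuous_on \<Theta> (obs_info f y)"
    and integrable_obs_info:
      "\<And>\<theta>. \<theta> \<in> \<Theta> \<Longrightarrow> integrable (model \<mu> f \<theta>) (\<lambda>y. obs_info f y \<theta>)"
    and integrable_score_cubed:
      "\<And>\<theta> t. \<theta> \<in> \<Theta> \<Longrightarrow> integrable (model \<mu> f \<theta>)
        (\<lambda>y. (score f y \<theta> $ t) *\<^sub>R outer (score f y \<theta>) (score f y \<theta>))"
    and integrable_score_obs_info:
      "\<And>\<theta> t. \<theta> \<in> \<Theta> \<Longrightarrow> integrable (model \<mu> f \<theta>)
        (\<lambda>y. (score f y \<theta> $ t) *\<^sub>R obs_info f y \<theta>)"
    and invertible_exp_info: "\<And>\<theta>. \<theta> \<in> \<Theta> \<Longrightarrow> invertible (exp_info \<mu> f \<theta>)"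

section \<open>Explicit median bias correction of a scalar focus parameter\<close>

definition omega ::
  "'y measure \<Rightarrow> (real^'p \<Rightarrow> 'y \<Rightarrow> real) \<Rightarrow> (real^'p \<Rightarrow> real) \<Rightarrow> real^'p \<Rightarrow> real^'p" where
  "omega \<mu> f h \<theta> = Vmat \<mu> f \<theta> *v grad h \<theta>"

definition kappa2 ::
  "'y measure \<Rightarrow> (real^'p \<Rightarrow> 'y \<Rightarrow> real) \<Rightarrow> (real^'p \<Rightarrow> real) \<Rightarrow> real^'p \<Rightarrow> real" where
  "kappa2 \<mu> f h \<theta> = omega \<mu> f h \<theta> \<bullet> grad h \<theta>"

definition kappa3 ::
  "'y measure \<Rightarrow> (real^'p \<Rightarrow> 'y \<Rightarrow> real) \<Rightarrow> (real^'p \<Rightarrow> real) \<Rightarrow> real^'p \<Rightarrow> real" where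
  "kappa3 \<mu> f h \<theta> =
    - 6 * (\<Sum>t\<in>UNIV. omega \<mu> f h \<theta> $ t * (omega \<mu> f h \<theta> \<bullet> (PQ \<mu> f t \<theta> *v omega \<mu> f h \<theta>)))
    + 3 * (omega \<mu> f h \<theta> \<bullet> (hessian h \<theta> *v omega \<mu> f h \<theta>))"

text \<open>First-order bias of \<open>h(\<theta>\<^sup>\<circ>)\<close> when \<open>\<theta>\<^sup>\<circ>\<close> is the maximum likelihood estimator and
  when it is the reduced mean-bias estimator, respectively.\<close>

definition bias_ml ::
  "'y measure \<Rightarrow> (real^'p \<Rightarrow> 'y \<Rightarrow> real) \<Rightarrow> (real^'p \<Rightarrow> real) \<Rightarrow> real^'p \<Rightarrow> real" where
  "bias_ml \<mu> f h \<theta> =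
    - ((Vmat \<mu> f \<theta> *v Avec \<mu> f \<theta>) \<bullet> grad h \<theta>) + 1/2 * trace (Vmat \<mu> f \<theta> ** hessian h \<theta>)"

definition bias_rb ::
  "'y measure \<Rightarrow> (real^'p \<Rightarrow> 'y \<Rightarrow> real) \<Rightarrow> (real^'p \<Rightarrow> real) \<Rightarrow> real^'p \<Rightarrow> real" where
  "bias_rb \<mu> f h \<theta> = 1/2 * trace (Vmat \<mu> f \<theta> ** hessian h \<theta>)"

definition median_bc_ml ::
  "'y measure \<Rightarrow> (real^'p \<Rightarrow> 'y \<Rightarrow> real) \<Rightarrow> (real^'p \<Rightarrow> real) \<Rightarrow> real^'p \<Rightarrow> real" where
  "median_bc_ml \<mu> f h \<theta> = h \<theta> - bias_ml \<mu> f h \<theta> + 1/6 * (kappa3 \<mu> f h \<theta> / kappa2 \<mu> f h \<theta>)"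

definition median_bc_rb ::
  "'y measure \<Rightarrow> (real^'p \<Rightarrow> 'y \<Rightarrow> real) \<Rightarrow> (real^'p \<Rightarrow> real) \<Rightarrow> real^'p \<Rightarrow> real" where
  "median_bc_rb \<mu> f h \<theta> = h \<theta> - bias_rb \<mu> f h \<theta> + 1/6 * (kappa3 \<mu> f h \<theta> / kappa2 \<mu> f h \<theta>)"

section \<open>Estimates and the quasi-Fisher scoring iteration\<close>

definition is_ml_estimate ::
  "(real^'p) set \<Rightarrow> (real^'p \<Rightarrow> 'y \<Rightarrow> real) \<Rightarrow> 'y \<Rightarrow> real^'p \<Rightarrow> bool" where
  "is_ml_estimate \<Theta> f y \<theta> \<longleftrightarrow>
    \<theta> \<in> \<Theta> \<and> (\<forall>\<tau>\<in>\<Theta>. loglik f y \<tau> \<le> loglik f y \<theta>)"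

definition is_rb_estimate ::
  "(real^'p) set \<Rightarrow> 'y measure \<Rightarrow> (real^'p \<Rightarrow> 'y \<Rightarrow> real) \<Rightarrow> 'y \<Rightarrow> real^'p \<Rightarrow> bool" where
  "is_rb_estimate \<Theta> \<mu> f y \<theta> \<longleftrightarrow> \<theta> \<in> \<Theta> \<and> score f y \<theta> + Avec \<mu> f \<theta> = 0"

text \<open>Left-hand side of the median bias-reducing adjusted score equations.\<close>

definition adjusted_score ::
  "'y measure \<Rightarrow> (real^'p \<Rightarrow> 'y \<Rightarrow> real) \<Rightarrow> 'y \<Rightarrow> real^'p \<Rightarrow> real^'p" where
  "adjusted_score \<mu> f y \<theta> =
    score f y \<theta> + Avec \<mu> f \<theta> - exp_info \<mu> f \<theta> *v Cvec \<mu> f \<theta>"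

definition quasi_fisher_step ::
  "'y measure \<Rightarrow> (real^'p \<Rightarrow> 'y \<Rightarrow> real) \<Rightarrow> 'y \<Rightarrow> real^'p \<Rightarrow> real^'p" where
  "quasi_fisher_step \<mu> f y \<theta> = \<theta> + Vmat \<mu> f \<theta> *v adjusted_score \<mu> f y \<theta>"

end

theory Submission
  imports Defs
begin

text \<open>For \<open>h \<theta> = \<theta>\<^sub>t\<close> the gradient is a unit vector and the Hessian vanishes, so \<open>\<omega>\<close> is
  the \<open>t\<close>-th \<^emph>\<open>column\<close> of \<open>V\<close>, whereas \<open>C\<close> is built from \<^emph>\<open>rows\<close> of \<open>V\<close>. The correction
  \<open>\<kappa>\<^sub>3 / (6 \<kappa>\<^sub>2)\<close> is therefore \<open>- C\<^sub>t\<close> because \<open>V\<close> is symmetric, which comes from the symmetry of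
  second derivatives of the log-likelihood. The claims about the scoring step
  then follow from \<open>V i = 1\<close>. When \<open>V\<^sub>t\<^sub>t = 0\<close>, both \<open>C\<^sub>t\<close> and
  \<open>\<kappa>\<^sub>3 / \<kappa>\<^sub>2\<close> are \<open>0\<close> by the convention \<open>x / 0 = 0\<close>.\<close>

section \<open>Symmetry of the Hessian\<close>

text \<open>The mean value theorem is used twice, first in direction \<open>u\<close> and then in
  direction \<open>v\<close>. The intermediate point may depend on which direction comes first,
  although the second difference does not.\<close>

lemma second_difference_mvt:
  fixes F :: "'a::real_normed_vector \<Rightarrow> real"
  assumes h: "0 < h"
    and F: "\<And>s t. 0 \<le> s \<Longrightarrow> s \<le> h \<Longrightarrow> 0 \<le> t \<Longrightarrow> t \<le> h \<Longrightarrow>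
      (F has_derivative F' (x + s *\<^sub>R u + t *\<^sub>R v)) (at (x + s *\<^sub>R u + t *\<^sub>R v))"
    and F': "\<And>s t. 0 \<le> s \<Longrightarrow> s \<le> h \<Longrightarrow> 0 \<le> t \<Longrightarrow> t \<le> h \<Longrightarrow>
      ((\<lambda>z. F' z u) has_derivative F'' (x + s *\<^sub>R u + t *\<^sub>R v)) (at (x + s *\<^sub>R u + t *\<^sub>R v))"
  obtains s t where "0 \<le> s" "s \<le> h" "0 \<le> t" "t \<le> h"
    "F (x + h *\<^sub>R u + h *\<^sub>R v) - F (x + h *\<^sub>R u) - F (x + h *\<^sub>R v) + F x
      = h\<^sup>2 * F'' (x + s *\<^sub>R u + t *\<^sub>R v) v"
proof -
  \<comment> \<open>\<open>\<phi>\<close> is the first difference in direction \<open>v\<close>, so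
    \<open>\<phi> h - \<phi> 0\<close> is the second difference.\<close>
  define \<phi> where "\<phi> s = F (x + s *\<^sub>R u + h *\<^sub>R v) - F (x + s *\<^sub>R u)" for s
  have F_line: "((\<lambda>s. F (x + s *\<^sub>R u + t *\<^sub>R v)) has_real_derivative
      F' (x + s *\<^sub>R u + t *\<^sub>R v) u) (at s)"
    if "0 \<le> s" "s \<le> h" "0 \<le> t" "t \<le> h" for s t
  proof -
    have lin: "linear (F' (x + s *\<^sub>R u + t *\<^sub>R v))"
      using F[OF that] by (rule has_derivative_linear)
    have "((\<lambda>s. F (x + s *\<^sub>R u + t *\<^sub>R v)) has_derivative
        (\<lambda>k. F' (x + s *\<^sub>R u + t *\<^sub>R v) (k *\<^sub>R u))) (at s)"
      by (rule has_derivative_compose[where f = "\<lambda>s. x + s *\<^sub>R u + t *\<^sub>R v" and g = F, OF _ F[OF that]]) (auto intro!: derivative_eq_intros)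
    then show ?thesis
      by (simp add: has_field_derivative_def linear_scale[OF lin] mult.commute[of _ "F' _ _"])
  qed
  have "(\<phi> has_real_derivative F' (x + s *\<^sub>R u + h *\<^sub>R v) u - F' (x + s *\<^sub>R u) u) (at s)"
    if "0 \<le> s" "s \<le> h" for s
    unfolding \<phi>_def using F_line[of s h] F_line[of s 0] that h
    by (auto intro!: derivative_intros)
  from MVT2[OF h this] obtain s where s: "0 < s" "s < h"
    and \<phi>: "\<phi> h - \<phi> 0 = h * (F' (x + s *\<^sub>R u + h *\<^sub>R v) u - F' (x + s *\<^sub>R u) u)"
    by auto
  \<comment> \<open>With \<open>s\<close> now fixed, the bracket in the equation for
    \<open>\<phi>\<close> is itself an increment in \<open>t\<close> of the derivative along
    \<open>u\<close>.\<close>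
  have "((\<lambda>t. F' (x + s *\<^sub>R u + t *\<^sub>R v) u) has_real_derivative
      F'' (x + s *\<^sub>R u + t *\<^sub>R v) v) (at t)" if "0 \<le> t" "t \<le> h" for t
  proof -
    have *: "((\<lambda>z. F' z u) has_derivative F'' (x + s *\<^sub>R u + t *\<^sub>R v))
        (at (x + s *\<^sub>R u + t *\<^sub>R v))"
      using F'[of s t] s that by simp
    have "((\<lambda>t. F' (x + s *\<^sub>R u + t *\<^sub>R v) u) has_derivative
        (\<lambda>k. F'' (x + s *\<^sub>R u + t *\<^sub>R v) (k *\<^sub>R v))) (at t)"
      by (rule has_derivative_compose[where f = "\<lambda>t. x + s *\<^sub>R u + t *\<^sub>R v", OF _ *]) (auto intro!: derivative_eq_intros)
    then show ?thesis
      by (simp add: has_field_derivative_def linear_scale[OF has_derivative_linear[OF *]]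
          mult.commute[of _ "F'' _ _"])
  qed
  from MVT2[OF h this] obtain t where t: "0 < t" "t < h"
    and "F' (x + s *\<^sub>R u + h *\<^sub>R v) u - F' (x + s *\<^sub>R u) u = h * F'' (x + s *\<^sub>R u + t *\<^sub>R v) v"
    by auto
  with \<phi> have "F (x + h *\<^sub>R u + h *\<^sub>R v) - F (x + h *\<^sub>R u) - F (x + h *\<^sub>R v) + F x
      = h\<^sup>2 * F'' (x + s *\<^sub>R u + t *\<^sub>R v) v"
    by (simp add: \<phi>_def power2_eq_square)
  with s t show thesis
    by (intro that[of s t]) auto
qed

text \<open>Specialises the double mean value theorem to coordinate directions. Exchanging
  \<open>c\<close> and \<open>d\<close> leaves the left-hand side unchanged but transposes the
  Hessian entry on the right.\<close>

lemma hessian_second_difference: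
  fixes F :: "real^'p \<Rightarrow> real"
  assumes F: "\<And>z. z \<in> ball x r \<Longrightarrow> F differentiable (at z)"
    and G: "\<And>z. z \<in> ball x r \<Longrightarrow> grad F differentiable (at z)"
    and h: "0 < h" "2 * h < r"
  obtains z where "z \<in> ball x r"
    "F (x + h *\<^sub>R axis c 1 + h *\<^sub>R axis d 1) - F (x + h *\<^sub>R axis c 1) - F (x + h *\<^sub>R axis d 1) + F x
      = h\<^sup>2 * hessian F z $ d $ c"
proof -
  \<comment> \<open>Unit axis vectors make the offset at most \<open>s + t\<close>, hence at most
    \<open>2 * h < r\<close>.\<close>
  have in_ball: "x + s *\<^sub>R axis c 1 + t *\<^sub>R axis d 1 \<in> ball x r"
    if "0 \<le> s" "s \<le> h" "0 \<le> t" "t \<le> h" for s t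
  proof -
    have "norm (s *\<^sub>R axis c 1 + t *\<^sub>R axis d 1 :: real^'p) \<le> \<bar>s\<bar> + \<bar>t\<bar>"
      by (rule norm_triangle_le) (simp add: norm_axis_1)
    moreover have "dist x (x + w) = norm w" for w :: "real^'p"
      by (simp add: dist_norm)
    ultimately show ?thesis
      using that h by (simp add: add.assoc)
  qed
  have G_c: "(\<lambda>z. grad F z $ c) differentiable (at z)" if "z \<in> ball x r" for z
    using G[OF that] by (auto simp: differentiable_def intro: bounded_linear.has_derivative[OF bounded_linear_vec_nth])
  have partial: "(\<lambda>z. frechet_derivative F (at z) (axis c 1)) = (\<lambda>z. grad F z $ c)"
    by (simp add: grad_def)
  obtain s t where st: "0 \<le> s" "s \<le> h" "0 \<le> t" "t \<le> h"
    and eq: "F (x + h *\<^sub>R axis c 1 + h *\<^sub>R axis d 1) - F (x + h *\<^sub>R axis c 1)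
        - F (x + h *\<^sub>R axis d 1) + F x
      = h\<^sup>2 * frechet_derivative (\<lambda>z. grad F z $ c)
          (at (x + s *\<^sub>R axis c 1 + t *\<^sub>R axis d 1)) (axis d 1)"
  proof (rule second_difference_mvt[OF h(1)])
    show "(F has_derivative frechet_derivative F (at (x + s *\<^sub>R axis c 1 + t *\<^sub>R axis d 1)))
        (at (x + s *\<^sub>R axis c 1 + t *\<^sub>R axis d 1))"
      if "0 \<le> s" "s \<le> h" "0 \<le> t" "t \<le> h" for s t
      using F[OF in_ball[OF that]] by (simp add: frechet_derivative_works)
    show "((\<lambda>z. frechet_derivative F (at z) (axis c 1)) has_derivative
        frechet_derivative (\<lambda>z. grad F z $ c) (at (x + s *\<^sub>R axis c 1 + t *\<^sub>R axis d 1)))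
        (at (x + s *\<^sub>R axis c 1 + t *\<^sub>R axis d 1))"
      if "0 \<le> s" "s \<le> h" "0 \<le> t" "t \<le> h" for s t
      unfolding partial using G_c[OF in_ball[OF that]] by (simp add: frechet_derivative_works)
  qed
  show thesis
    using that[OF in_ball[OF st]] eq by (simp add: hessian_def grad_def[of "\<lambda>z. grad F z $ c"])
qed

text \<open>Schwarz's theorem: one second difference equals the same multiple of entry
  \<open>(d, c)\<close> at a nearby point and of entry \<open>(c, d)\<close> at another. Continuity
  of the Hessian carries this equality to \<open>x\<close>.\<close>

lemma hessian_symmetric:
  fixes F :: "real^'p \<Rightarrow> real"
  assumes S: "open S" "x \<in> S"
    and F: "F differentiable_on S"
    and G: "grad F differentiable_on S"
    and H: "continuous_on S (hessian F)"
  shows "hessian F x $ d $ c = hessian F x $ c $ d"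
proof (rule ccontr)
  assume neq: "hessian F x $ d $ c \<noteq> hessian F x $ c $ d"
  \<comment> \<open>With half the gap as tolerance, equal entries at two nearby points would force
    the gap at \<open>x\<close> to be strictly less than \<open>2 * e\<close>, which is the gap
    itself.\<close>
  define e where "e = \<bar>hessian F x $ d $ c - hessian F x $ c $ d\<bar> / 2"
  have "0 < e"
    using neq by (simp add: e_def)
  have "isCont (hessian F) x"
    using H S by (simp add: continuous_on_eq_continuous_at)
  then obtain r1 where r1: "0 < r1" "\<And>z. dist z x < r1 \<Longrightarrow> dist (hessian F z) (hessian F x) < e"
    using \<open>0 < e\<close> unfolding continuous_at_eps_delta by blast
  \<comment> \<open>An entry is bounded by the norm of its row, and that by the norm of the matrix,
    so one radius serves all entries.\<close>
  have near: "\<bar>hessian F z $ a $ b - hessian F x $ a $ b\<bar> < e" if "z \<in> ball x r1" for z a b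
  proof -
    have "\<bar>(hessian F z - hessian F x) $ a $ b\<bar> \<le> norm ((hessian F z - hessian F x) $ a)"
      by (rule component_le_norm_cart)
    also have "\<dots> \<le> norm (hessian F z - hessian F x)"
      by (rule Finite_Cartesian_Product.norm_nth_le)
    also have "\<dots> < e"
      using r1(2)[of z] that by (simp add: dist_norm dist_commute norm_minus_commute)
    finally show ?thesis by simp
  qed
  obtain r2 where r2: "0 < r2" "ball x r2 \<subseteq> S"
    using S open_contains_ball by blast
  define r where "r = min r1 r2"
  have r: "0 < r" "ball x r \<subseteq> S" "ball x r \<subseteq> ball x r1"
    using r1 r2 by (auto simp: r_def)
  have dF: "F differentiable (at z)" "grad F differentiable (at z)" if "z \<in> ball x r" for z
    using F G S r that by (auto simp: differentiable_on_eq_differentiable_at)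
  have h: "0 < r / 3" "2 * (r / 3) < r"
    using r by auto
  obtain z where z: "z \<in> ball x r"
    "F (x + (r/3) *\<^sub>R axis c 1 + (r/3) *\<^sub>R axis d 1) - F (x + (r/3) *\<^sub>R axis c 1)
        - F (x + (r/3) *\<^sub>R axis d 1) + F x = (r/3)\<^sup>2 * hessian F z $ d $ c"
    using hessian_second_difference[OF dF h] by blast
  \<comment> \<open>Same increment with the two axes exchanged: the left-hand side is the one for
    \<open>z\<close> up to reordering.\<close>
  obtain w where w: "w \<in> ball x r"
    "F (x + (r/3) *\<^sub>R axis d 1 + (r/3) *\<^sub>R axis c 1) - F (x + (r/3) *\<^sub>R axis d 1)
        - F (x + (r/3) *\<^sub>R axis c 1) + F x = (r/3)\<^sup>2 * hessian F w $ c $ d"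
    using hessian_second_difference[OF dF h] by blast
  have "(r/3)\<^sup>2 * hessian F z $ d $ c = (r/3)\<^sup>2 * hessian F w $ c $ d"
    unfolding z(2)[symmetric] w(2)[symmetric] by (simp add: add_ac)
  then have "hessian F z $ d $ c = hessian F w $ c $ d"
    using r by simp
  moreover have "\<bar>hessian F z $ d $ c - hessian F x $ d $ c\<bar> < e"
    "\<bar>hessian F w $ c $ d - hessian F x $ c $ d\<bar> < e"
    using near z(1) w(1) r(3) by auto
  ultimately show False
    unfolding e_def by (simp add: abs_if field_simps split: if_splits)
qed

section \<open>Symmetry of the information matrix and its inverse\<close>

lemma matrix_inv_left_right:
  assumes "invertible A"
  shows "A ** matrix_inv A = mat 1" "matrix_inv A ** A = mat 1"
  using someI_ex[OF assms[unfolded invertible_def]] by (simp_all add: matrix_inv_def)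

text \<open>Transposing \<open>A ** matrix_inv A = mat 1\<close> makes the transposed inverse a left
  inverse of \<open>A\<close>; multiplying by \<open>matrix_inv A\<close> on the right identifies
  the two.\<close>

lemma transpose_matrix_inv_eq:
  fixes A :: "real^'n^'n"
  assumes A: "invertible A" and sym: "transpose A = A"
  shows "transpose (matrix_inv A) = matrix_inv A"
proof -
  have "transpose (matrix_inv A) ** A = mat 1"
    using arg_cong[OF matrix_inv_left_right(1)[OF A], of transpose]
    by (simp add: matrix_transpose_mul sym)
  then have "transpose (matrix_inv A) ** A ** matrix_inv A = matrix_inv A"
    by simp
  then show ?thesis
    by (simp add: matrix_inv_left_right(1)[OF A] flip: matrix_mul_assoc)
qed

lemma matrix_integral_nth:
  fixes g :: "'y \<Rightarrow> real^'m^'n"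
  assumes "integrable M g"
  shows "(\<integral>y. g y \<partial>M) $ a $ b = (\<integral>y. g y $ a $ b \<partial>M)"
proof -
  have "bounded_linear (\<lambda>X::real^'m^'n. X $ a $ b)"
    by (intro bounded_linear_compose[OF bounded_linear_vec_nth bounded_linear_vec_nth])
  from integral_bounded_linear[OF this assms] show ?thesis by simp
qed

context regular_model
begin

lemma obs_info_symmetric:
  assumes "y \<in> space \<mu>" "\<theta> \<in> \<Theta>"
  shows "obs_info f y \<theta> $ a $ b = obs_info f y \<theta> $ b $ a"
proof -
  have score: "score f y = grad (loglik f y)"
    by (simp add: fun_eq_iff score_def)
  have obs_info: "hessian (loglik f y) = (\<lambda>\<tau>. - obs_info f y \<tau>)"
    by (simp add: fun_eq_iff obs_info_def)
  have "hessian (loglik f y) \<theta> $ a $ b = hessian (loglik f y) \<theta> $ b $ a"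
  proof (rule hessian_symmetric[OF open_params assms(2) loglik_differentiable[OF assms(1)]])
    show "grad (loglik f y) differentiable_on \<Theta>"
      using score_differentiable[OF assms(1)] by (simp add: score)
    show "continuous_on \<Theta> (hessian (loglik f y))"
      unfolding obs_info using obs_info_continuous[OF assms(1)] by (rule continuous_on_minus)
  qed
  then show ?thesis
    by (simp add: obs_info_def)
qed

text \<open>Taking an entry is bounded linear and commutes with the integral; \<open>model\<close>
  has the same space as \<open>\<mu>\<close>, so the pointwise symmetry of the observed information
  applies under the integral.\<close>

lemma transpose_exp_info:
  assumes "\<theta> \<in> \<Theta>"
  shows "transpose (exp_info \<mu> f \<theta>) = exp_info \<mu> f \<theta>"
proof -
  have "exp_info \<mu> f \<theta> $ a $ b = exp_info \<mu> f \<theta> $ b $ a" for a b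
    unfolding exp_info_def matrix_integral_nth[OF integrable_obs_info[OF assms]]
    by (intro Bochner_Integration.integral_cong) (auto simp: model_def intro: obs_info_symmetric assms)
  then show ?thesis
    by (simp add: transpose_def vec_eq_iff)
qed

lemma Vmat_symmetric:
  assumes "\<theta> \<in> \<Theta>"
  shows "Vmat \<mu> f \<theta> $ a $ b = Vmat \<mu> f \<theta> $ b $ a"
proof -
  have "transpose (Vmat \<mu> f \<theta>) = Vmat \<mu> f \<theta>"
    unfolding Vmat_def
    by (rule transpose_matrix_inv_eq[OF invertible_exp_info[OF assms] transpose_exp_info[OF assms]])
  then have "transpose (Vmat \<mu> f \<theta>) $ a $ b = Vmat \<mu> f \<theta> $ a $ b"
    by (rule arg_cong)
  then show ?thesis
    by (simp add: transpose_def)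
qed

lemma Vmat_exp_info_mult:
  assumes "\<theta> \<in> \<Theta>"
  shows "Vmat \<mu> f \<theta> *v (exp_info \<mu> f \<theta> *v x) = x"
  by (simp add: Vmat_def matrix_vector_mul_assoc matrix_inv_left_right invertible_exp_info[OF assms])

end

section \<open>Coordinate focus parameters\<close>

lemma grad_coordinate:
  fixes \<theta> :: "real^'p"
  shows "grad (\<lambda>\<tau>. \<tau> $ t) \<theta> = axis t 1"
proof -
  have "((\<lambda>\<tau>::real^'p. \<tau> $ t) has_derivative (\<lambda>\<tau>. \<tau> $ t)) (at \<theta>)"
    by (rule bounded_linear_imp_has_derivative[OF bounded_linear_vec_nth])
  from frechet_derivative_at[OF this] show ?thesis
    by (auto simp: grad_def vec_eq_iff axis_def)
qed

lemma hessian_coordinate: "hessian (\<lambda>\<tau>. \<tau> $ t) \<theta> = 0"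
  by (simp add: hessian_def grad_coordinate grad_def vec_eq_iff)

text \<open>Links the two notations: the traces in \<open>Dmat\<close> become the quadratic forms
  that occur in \<open>kappa3\<close>.\<close>

lemma trace_outer_mult: "trace (outer u v ** M) = v \<bullet> (M *v u)"
proof -
  have "trace (outer u v ** M) = (\<Sum>i\<in>UNIV. \<Sum>k\<in>UNIV. u $ i * v $ k * M $ k $ i)"
    by (simp add: trace_def matrix_matrix_mult_def outer_def)
  also have "\<dots> = (\<Sum>k\<in>UNIV. \<Sum>i\<in>UNIV. v $ k * (M $ k $ i * u $ i))"
    by (subst sum.swap) (simp add: mult_ac)
  finally show ?thesis
    by (simp add: inner_vec_def matrix_vector_mult_def sum_distrib_left)
qed

context regular_model
begin

lemma omega_coordinate:
  assumes "\<theta> \<in> \<Theta>"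
  shows "omega \<mu> f (\<lambda>\<tau>. \<tau> $ t) \<theta> = row t (Vmat \<mu> f \<theta>)"
proof -
  have "omega \<mu> f (\<lambda>\<tau>. \<tau> $ t) \<theta> $ s = Vmat \<mu> f \<theta> $ s $ t" for s
    by (simp add: omega_def grad_coordinate matrix_vector_mul_component inner_axis)
  then show ?thesis
    by (simp add: vec_eq_iff row_def Vmat_symmetric[OF assms, of t])
qed

lemma median_correction_coordinate:
  assumes "\<theta> \<in> \<Theta>"
  shows "1/6 * (kappa3 \<mu> f (\<lambda>\<tau>. \<tau> $ t) \<theta> / kappa2 \<mu> f (\<lambda>\<tau>. \<tau> $ t) \<theta>) = - Cvec \<mu> f \<theta> $ t"
proof -
  let ?V = "Vmat \<mu> f \<theta>"
  let ?q = "\<lambda>s. row t ?V \<bullet> (PQ \<mu> f s \<theta> *v row t ?V)"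
  \<comment> \<open>The divisor comes from the normalisation of \<open>Emat\<close>; it is the same
    diagonal entry that appears below as \<open>kappa2\<close>.\<close>
  have D: "Dmat \<mu> f \<theta> $ t $ s = ?q s / ?V $ t $ t" for s
  proof -
    have "Dmat \<mu> f \<theta> $ t $ s = 1 / ?V $ t $ t * trace (outer (row t ?V) (row t ?V) ** PQ \<mu> f s \<theta>)"
      by (simp add: Dmat_def Emat_def trace_def matrix_matrix_mult_def sum_distrib_left mult.assoc)
    then show ?thesis
      by (simp add: trace_outer_mult)
  qed
  have \<kappa>2: "kappa2 \<mu> f (\<lambda>\<tau>. \<tau> $ t) \<theta> = ?V $ t $ t"
    by (simp add: kappa2_def omega_coordinate[OF assms] grad_coordinate inner_axis row_def)
  have \<kappa>3: "kappa3 \<mu> f (\<lambda>\<tau>. \<tau> $ t) \<theta> = - 6 * (\<Sum>s\<in>UNIV. ?V $ t $ s * ?q s)"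
    by (simp add: kappa3_def omega_coordinate[OF assms] hessian_coordinate row_def)
  have C: "Cvec \<mu> f \<theta> $ t = (\<Sum>s\<in>UNIV. ?V $ t $ s * ?q s) / ?V $ t $ t"
    by (simp add: Cvec_def D sum_divide_distrib)
  show ?thesis
    unfolding \<kappa>2 \<kappa>3 C by simp
qed

lemma median_bc_rb_coordinates:
  assumes "\<theta> \<in> \<Theta>"
  shows "(\<chi> t. median_bc_rb \<mu> f (\<lambda>\<tau>. \<tau> $ t) \<theta>) = \<theta> - Cvec \<mu> f \<theta>"
  unfolding median_bc_rb_def median_correction_coordinate[OF assms]
  by (simp add: bias_rb_def hessian_coordinate vec_eq_iff trace_def)

lemma median_bc_ml_coordinates:
  assumes "\<theta> \<in> \<Theta>"
  shows "(\<chi> t. median_bc_ml \<mu> f (\<lambda>\<tau>. \<tau> $ t) \<theta>) = \<theta> + Vmat \<mu> f \<theta> *v Avec \<mu> f \<theta> - Cvec \<mu> f \<theta>"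
  unfolding median_bc_ml_def median_correction_coordinate[OF assms]
  by (simp add: bias_ml_def grad_coordinate hessian_coordinate inner_axis vec_eq_iff trace_def)

text \<open>Since \<open>V\<close> inverts the information, the term \<open>i C\<close> contributes
  exactly \<open>C\<close>. What remains depends on the start only through \<open>s + A\<close>,
  which is \<open>A\<close> where the score vanishes and \<open>0\<close> at the reduced mean-bias
  estimate.\<close>

lemma quasi_fisher_step_eq:
  assumes "\<theta> \<in> \<Theta>"
  shows "quasi_fisher_step \<mu> f y \<theta> =
    \<theta> + Vmat \<mu> f \<theta> *v (score f y \<theta> + Avec \<mu> f \<theta>) - Cvec \<mu> f \<theta>"
  by (simp add: quasi_fisher_step_def adjusted_score_def matrix_vector_mult_diff_distrib
      Vmat_exp_info_mult[OF assms])

end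

theorem mainTheorem2:
  fixes \<Theta> :: "(real^'p) set"
    and \<mu> :: "'y measure"
    and f :: "real^'p \<Rightarrow> 'y \<Rightarrow> real"
    and y :: 'y
  assumes "regular_model \<Theta> \<mu> f"
    and "y \<in> space \<mu>"
  shows
    "(\<forall>\<theta>. is_ml_estimate \<Theta> f y \<theta> \<longrightarrow> score f y \<theta> = 0 \<longrightarrow>
        (\<chi> t. median_bc_ml \<mu> f (\<lambda>\<tau>. \<tau> $ t) \<theta>) = \<theta> + Vmat \<mu> f \<theta> *v Avec \<mu> f \<theta> - Cvec \<mu> f \<theta>
      \<and> \<theta> + Vmat \<mu> f \<theta> *v Avec \<mu> f \<theta> - Cvec \<mu> f \<theta> = quasi_fisher_step \<mu> f y \<theta>)
   \<and> (\<forall>\<theta>. is_rb_estimate \<Theta> \<mu> f y \<theta> \<longrightarrow>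
        (\<chi> t. median_bc_rb \<mu> f (\<lambda>\<tau>. \<tau> $ t) \<theta>) = \<theta> - Cvec \<mu> f \<theta>
      \<and> \<theta> - Cvec \<mu> f \<theta> = quasi_fisher_step \<mu> f y \<theta>)"
proof -
  interpret regular_model \<Theta> \<mu> f by fact
  show ?thesis
    by (simp add: is_ml_estimate_def is_rb_estimate_def median_bc_ml_coordinates
        median_bc_rb_coordinates quasi_fisher_step_eq)
qed

end
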